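(* Consider the setting $m=1$, $f=0$, $X=[-1/2,1/2]$, $C=\mathbb{R}$. For $\alpha>0$, let $\mathcal{P}_{\mathrm{cont,sym},\alpha}$ be the class of distributions $\mathbb{P}$ on $W\times\mathbb{R}$ such that for every $w\in W$ the conditional distribution of $c$ given $w$ is continuous and symmetric and $\left|\mathbb{P}[c>0\mid w]-\mathbb{P}[c<0\mid w]\right|\ge\alpha$. Then $\ell_{\mathrm{SPO+}}$ is $\mathcal{P}_{\mathrm{cont,sym},\alpha}$-uniformly calibrated, and for every $\mathbb{P}\in\mathcal{P}_{\mathrm{cont,sym},\alpha}$ with $\mathbb{E}[|c|]<\infty$ and every measurable $g:W\to\mathbb{R}$, $$R(g,\mathbb{P})-R(\mathbb{P})\le\frac1\alpha\left(R_{\ell_{\mathrm{SPO+}}}(g,\mathbb{P})-R_{\ell_{\mathrm{SPO+}}}(\mathbb{P})\right).$$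
   Context: A probability distribution on $\mathbb{R}$ is called continuous if it has a density with respect to Lebesgue measure that is positive on all of $\mathbb{R}$, and symmetric if it has finite mean $\mu$ and, for $c$ with this distribution, $c-\mu$ and $\mu-c$ have the same distribution. One-dimensional setting: $m=1$, $f=0$, $X=[-1/2,1/2]$, $C=\mathbb{R}$, $W\subseteq\mathbb{R}^k$ measurable. Here $x^*(d)=-1/2$ if $d>0$, $x^*(0)=0$, $x^*(d)=1/2$ if $d<0$; the true loss is $L(d,c):=c\,x^*(d)-\min_{x\in X}cx$; and $$\ell_{\mathrm{SPO+}}(d,c):=\tfrac12\left(|2d-c|-2d\,\mathrm{sign}(c)+|c|\right),\quad \mathrm{sign}(0)=0.$$ For a distribution $\mathbb{P}$ on $W\times\mathbb{R}$, $(w,c)\sim\mathbb{P}$ and $\mathbb{P}[\cdot\mid w]$, $\mathbb{E}[\cdot\mid w]$ refer to a fixed regular conditional distribution of $c$ defined for every $w\in W$. For measurable $g:W\to\mathbb{R}$: $R(g,\mathbb{P}):=\mathbb{E}[L(g(w),c)]$, $R(\mathbb{P}):=\inf_gR(g,\mathbb{P})$, $R_\ell(g,\mathbb{P}):=\mathbb{E}[\ell(g(w),c)]$, $R_\ell(\mathbb{P}):=\inf_gR_\ell(g,\mathbb{P})$, infima over measurable $g$. A loss $\ell$ is $\mathcal{P}$-uniformly calibrated if for all $\epsilon>0$ there is $\delta>0$ such that for all $\mathbb{P}\in\mathcal{P}$, $w\in W$, $d\in\mathbb{R}$: $\mathbb{E}[\ell(d,c)\mid w]-\inf_{d'}\mathbb{E}[\ell(d',c)\mid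 w]<\delta$ implies $\mathbb{E}[L(d,c)\mid w]-\inf_{d'}\mathbb{E}[L(d',c)\mid w]<\epsilon$. *)

theory Defs
  imports "HOL-Probability.Probability"
begin

definition feasible :: "real set" where
  "feasible = {-1/2..1/2}"

definition oracle_sol :: "real \<Rightarrow> real" where
  "oracle_sol d = (if d > 0 then - 1/2 else if d = 0 then 0 else 1/2)"

definition true_loss :: "real \<Rightarrow> real \<Rightarrow> real" where
  "true_loss d c = c * oracle_sol d - (INF x\<in>feasible. c * x)"

definition spo_plus_loss :: "real \<Rightarrow> real \<Rightarrow> real" where
  "spo_plus_loss d c = 1/2 * (\<bar>2 * d - c\<bar> - 2 * d * sgn c + \<bar>c\<bar>)"

text \<open>Expectations are extended-real valued, because \<open>spo_plus_loss (g w) c\<close> need not be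
  integrable for every measurable \<open>g\<close>: its risk is then \<open>\<infinity>\<close>, whereas the Bochner integral
  would return 0 and corrupt the infimum over \<open>g\<close>.\<close>

definition expect :: "'a measure \<Rightarrow> ('a \<Rightarrow> real) \<Rightarrow> ereal" where
  "expect M X = enn2ereal (\<integral>\<^sup>+x. ennreal (X x) \<partial>M) - enn2ereal (\<integral>\<^sup>+x. ennreal (- X x) \<partial>M)"

definition continuous_distribution :: "real measure \<Rightarrow> bool" where
  "continuous_distribution M \<longleftrightarrow>
    (\<exists>f::real \<Rightarrow> real. f \<in> borel_measurable borel \<and> (\<forall>x. f x > 0) \<and>
      M = density lborel (\<lambda>x. ennreal (f x)))"

definition symmetric_distribution :: "real measure \<Rightarrow> bool" where
  "symmetric_distribution M \<longleftrightarrow> integrable M (\<lambda>c. c) \<and>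
    (let \<mu> = (\<integral>c. c \<partial>M) in distr M borel (\<lambda>c. c - \<mu>) = distr M borel (\<lambda>c. \<mu> - c))"

text \<open>\<open>K w\<close> is the conditional distribution of \<open>c\<close> given \<open>w\<close>, for \<open>(w, c)\<close> distributed
  according to \<open>P\<close>. Since \<open>P\<close> determines \<open>K\<close> only up to null sets, a distribution with its fixed
  regular conditional distribution is modelled as the pair \<open>(P, K)\<close>.\<close>

definition regular_conditional ::
  "'a::topological_space set \<Rightarrow> ('a \<times> real) measure \<Rightarrow> ('a \<Rightarrow> real measure) \<Rightarrow> bool" where
  "regular_conditional W P K \<longleftrightarrow>
    K \<in> restrict_space borel W \<rightarrow>\<^sub>M prob_algebra borel \<and>
    (\<forall>A\<in>sets (restrict_space borel W). \<forall>B\<in>sets borel.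
      emeasure P (A \<times> B) =
        (\<integral>\<^sup>+w\<in>A. emeasure (K w) B \<partial>distr P (restrict_space borel W) fst))"

definition distributions_on ::
  "'a::topological_space set \<Rightarrow> (('a \<times> real) measure \<times> ('a \<Rightarrow> real measure)) set" where
  "distributions_on W = {(P, K). prob_space P \<and>
    sets P = sets (restrict_space borel W \<Otimes>\<^sub>M borel) \<and> regular_conditional W P K}"

definition cont_sym_distributions ::
  "'a::topological_space set \<Rightarrow> real \<Rightarrow> (('a \<times> real) measure \<times> ('a \<Rightarrow> real measure)) set" where
  "cont_sym_distributions W \<alpha> = {(P, K) \<in> distributions_on W. \<forall>w\<in>W.
    continuous_distribution (K w) \<and> symmetric_distribution (K w) \<and>
    \<bar>measure (K w) {c. c > 0} - measure (K w) {c. c < 0}\<bar> \<ge> \<alpha>}"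

definition risk :: "(real \<Rightarrow> real \<Rightarrow> real) \<Rightarrow> ('a \<Rightarrow> real) \<Rightarrow> ('a \<times> real) measure \<Rightarrow> ereal" where
  "risk l g P = expect P (\<lambda>(w, c). l (g w) c)"

definition min_risk ::
  "'a::topological_space set \<Rightarrow> (real \<Rightarrow> real \<Rightarrow> real) \<Rightarrow> ('a \<times> real) measure \<Rightarrow> ereal" where
  "min_risk W l P = (INF g\<in>borel_measurable (restrict_space borel W). risk l g P)"

definition uniformly_calibrated ::
  "'a::topological_space set \<Rightarrow> (('a \<times> real) measure \<times> ('a \<Rightarrow> real measure)) set
    \<Rightarrow> (real \<Rightarrow> real \<Rightarrow> real) \<Rightarrow> bool" where
  "uniformly_calibrated W \<P> l \<longleftrightarrow> (\<forall>\<epsilon>>0::real. \<exists>\<delta>>0::real. \<forall>(P, K)\<in>\<P>. \<forall>w\<in>W. \<forall>d::real.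
    expect (K w) (l d) - (INF d'. expect (K w) (l d')) < ereal \<delta> \<longrightarrow>
    expect (K w) (true_loss d) - (INF d'. expect (K w) (true_loss d')) < ereal \<epsilon>)"

end

theory Submission
  imports Defs
begin

text \<open>Let \<open>\<mu>\<close> be the conditional mean and \<open>p\<close> the conditional expectation of \<open>sgn c\<close>. Symmetry
  forces \<open>p\<close> to have the sign of \<open>\<mu>\<close>, and the expected SPO+ loss increases by at least
  \<open>\<mu> p \<ge> \<alpha> \<bar>\<mu>\<bar>\<close> when \<open>\<mu>\<close> is replaced by a prediction \<open>d\<close> of another sign. As the excess true
  loss is at most \<open>\<bar>\<mu>\<bar>\<close>, and vanishes when \<open>d\<close> has the sign of \<open>\<mu>\<close>, correcting \<open>d\<close> to \<open>\<mu>\<close>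
  exactly where the signs differ bounds the excess true loss by \<open>1/\<alpha>\<close> times the excess
  surrogate loss, both for a fixed \<open>w\<close> and, after integrating over \<open>w\<close>, for the risks. No
  minimiser of the surrogate risk is needed.\<close>

section \<open>The two losses, pointwise\<close>

text \<open>A linear function on the interval is least at an endpoint. What remains is linear in
  \<open>c\<close> apart from a term free of \<open>d\<close>, so in expectation the prediction
  matters only through the mean.\<close>

lemma true_loss_eq: "true_loss d c = c * oracle_sol d + \<bar>c\<bar> / 2"
proof -
  have "(INF x\<in>feasible. c * x) = - (\<bar>c\<bar> / 2)"
  proof (rule cInf_eq_minimum)
    have "- (\<bar>c\<bar> / 2) = c * (if 0 \<le> c then -1/2 else 1/2)"
      by auto
    then show "- (\<bar>c\<bar> / 2) \<in> (*) c ` feasible"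
      by (rule image_eqI) (auto simp: feasible_def)
  next
    fix y assume "y \<in> (*) c ` feasible"
    then obtain x where "y = c * x" "x \<in> feasible"
      by blast
    then have x: "y = c * x" "\<bar>x\<bar> \<le> 1/2"
      by (auto simp: feasible_def)
    have "\<bar>c * x\<bar> \<le> \<bar>c\<bar> * (1/2)"
      unfolding abs_mult using x by (intro mult_left_mono) auto
    then show "- (\<bar>c\<bar> / 2) \<le> y"
      using x by auto
  qed
  then show ?thesis
    by (simp add: true_loss_def)
qed

lemma true_loss_nonneg: "0 \<le> true_loss d c"
  by (auto simp: true_loss_eq oracle_sol_def)

lemma true_loss_le_abs: "true_loss d c \<le> \<bar>c\<bar>"
  by (auto simp: true_loss_eq oracle_sol_def)

lemma mult_oracle_sol_ge: "- (\<bar>m\<bar> / 2) \<le> m * oracle_sol d"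
  by (auto simp: oracle_sol_def)

lemma mult_oracle_sol_le: "m * oracle_sol d \<le> \<bar>m\<bar> / 2"
  by (auto simp: oracle_sol_def)

lemma mult_oracle_sol_self: "m * oracle_sol m = - (\<bar>m\<bar> / 2)"
  by (auto simp: oracle_sol_def)

lemma spo_plus_loss_nonneg: "0 \<le> spo_plus_loss d c"
  by (auto simp: spo_plus_loss_def sgn_if)

lemma spo_plus_loss_zero: "spo_plus_loss 0 c = \<bar>c\<bar>"
  by (simp add: spo_plus_loss_def)

lemma borel_measurable_oracle_sol [measurable]: "oracle_sol \<in> borel_measurable borel"
  unfolding oracle_sol_def by measurable

lemma borel_measurable_true_loss [measurable]:
  assumes [measurable]: "f \<in> borel_measurable M" "h \<in> borel_measurable M"
  shows "(\<lambda>x. true_loss (f x) (h x)) \<in> borel_measurable M"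
  unfolding true_loss_eq by measurable

lemma borel_measurable_spo_plus_loss [measurable]:
  assumes [measurable]: "f \<in> borel_measurable M" "h \<in> borel_measurable M"
  shows "(\<lambda>x. spo_plus_loss (f x) (h x)) \<in> borel_measurable M"
  unfolding spo_plus_loss_def sgn_if by measurable

text \<open>Both losses are nonnegative, so their expectations can be handled as
  \<open>ennreal\<close> integrals, where additivity and disintegration ask for measurability
  only.\<close>

lemma expect_nonneg:
  assumes "\<And>x. 0 \<le> X x"
  shows "expect M X = enn2ereal (\<integral>\<^sup>+x. ennreal (X x) \<partial>M)"
  using assms by (simp add: expect_def ennreal_neg zero_ennreal.rep_eq)

section \<open>Expected losses under an integrable distribution\<close>

locale integrable_real_distribution = prob_space Q for Q :: "real measure" +
  assumes sets_Q [measurable_cong]: "sets Q = sets borel"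
    and integrable_id: "integrable Q (\<lambda>c. c)"
begin

definition mean :: real where "mean = (\<integral>c. c \<partial>Q)"

definition sign_mean :: real where "sign_mean = (\<integral>c. sgn c \<partial>Q)"

lemma space_Q: "space Q = UNIV"
  using sets_eq_imp_space_eq[OF sets_Q] by simp

lemma integrable_abs: "integrable Q (\<lambda>c. \<bar>c\<bar>)"
  using integrable_id by (rule integrable_abs)

lemma integrable_sgn: "integrable Q (\<lambda>c. sgn c)"
proof (rule integrable_const_bound)
  show "AE c in Q. norm (sgn c) \<le> 1"
    by (auto simp: sgn_if)
  show "sgn \<in> borel_measurable Q"
    unfolding sgn_if by measurable
qed

lemma integrable_abs_diff: "integrable Q (\<lambda>c. \<bar>a - c\<bar>)"
  using integrable_id by auto

text \<open>Links \<open>sign_mean\<close> to the quantity that the class of distributions bounds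
  away from zero; the point 0 contributes to neither side.\<close>

lemma sign_mean_eq: "sign_mean = measure Q {c. 0 < c} - measure Q {c. c < 0}"
proof -
  have "sign_mean = (\<integral>c. indicator {c. 0 < c} c - indicator {c. c < 0} c \<partial>Q)"
    unfolding sign_mean_def by (intro Bochner_Integration.integral_cong) (auto simp: sgn_if)
  also have "\<dots> = measure Q {c. 0 < c} - measure Q {c. c < 0}"
    by (subst Bochner_Integration.integral_diff) (auto simp: space_Q sets_Q emeasure_finite less_top[symmetric])
  finally show ?thesis .
qed

lemma integrable_true_loss: "integrable Q (true_loss d)"
  unfolding true_loss_eq using integrable_id integrable_abs by auto

lemma integral_true_loss:
  "(\<integral>c. true_loss d c \<partial>Q) = mean * oracle_sol d + (\<integral>c. \<bar>c\<bar> \<partial>Q) / 2"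
  unfolding true_loss_eq mean_def using integrable_id integrable_abs by simp

lemma integrable_spo_plus_loss: "integrable Q (spo_plus_loss d)"
  unfolding spo_plus_loss_def using integrable_abs integrable_abs_diff integrable_sgn by auto

lemma integral_spo_plus_loss:
  "(\<integral>c. spo_plus_loss d c \<partial>Q) =
    1/2 * ((\<integral>c. \<bar>2 * d - c\<bar> \<partial>Q) - 2 * d * sign_mean + (\<integral>c. \<bar>c\<bar> \<partial>Q))"
  unfolding spo_plus_loss_def sign_mean_def
  using integrable_abs integrable_abs_diff integrable_sgn by simp

text \<open>The only term that depends on \<open>d\<close> is \<open>mean * oracle_sol d\<close>,
  and it reaches its lower bound, minus half of |mean|, at \<open>d = mean\<close>.\<close>

lemma integral_true_loss_mean_le: "(\<integral>c. true_loss mean c \<partial>Q) \<le> (\<integral>c. true_loss d c \<partial>Q)"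
  using mult_oracle_sol_ge[of mean d] by (simp add: integral_true_loss mult_oracle_sol_self)

text \<open>This is convexity of \<open>d \<mapsto> \<bar>2 * d - c\<bar>\<close> at \<open>d = 0\<close>, whose subgradient there contains
  \<open>- 2 * sgn c\<close>.\<close>

lemma integral_abs_diff_ge:
  "(\<integral>c. \<bar>c\<bar> \<partial>Q) - 2 * d * sign_mean \<le> (\<integral>c. \<bar>2 * d - c\<bar> \<partial>Q)"
proof -
  have "(\<integral>c. \<bar>c\<bar> - 2 * d * sgn c \<partial>Q) \<le> (\<integral>c. \<bar>2 * d - c\<bar> \<partial>Q)"
    using integrable_abs integrable_abs_diff integrable_sgn
    by (intro integral_mono) (auto simp: sgn_if)
  then show ?thesis
    using integrable_abs integrable_sgn by (simp add: sign_mean_def)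
qed

end

section \<open>Symmetry and sign correction\<close>

locale symmetric_real_distribution = integrable_real_distribution +
  assumes symmetric: "distr Q borel (\<lambda>c. c - mean) = distr Q borel (\<lambda>c. mean - c)"
begin

lemma integral_abs_reflect: "(\<integral>c. \<bar>2 * mean - c\<bar> \<partial>Q) = (\<integral>c. \<bar>c\<bar> \<partial>Q)"
proof -
  \<comment> \<open>The test function undoes the centring: at \<open>c - mean\<close> it gives |c|,
    at \<open>mean - c\<close> it gives |2 * mean - c|.\<close>
  have "(\<integral>x. \<bar>x + mean\<bar> \<partial>distr Q borel (\<lambda>c. c - mean)) =
      (\<integral>x. \<bar>x + mean\<bar> \<partial>distr Q borel (\<lambda>c. mean - c))"
    by (simp add: symmetric)
  then show ?thesis
    by (simp add: integral_distr algebra_simps)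
qed

text \<open>Reflection about \<open>mean\<close> carries the positive half-line to the half-line
  below \<open>2 * mean\<close>. Both probabilities in \<open>sign_mean_eq\<close> then belong to
  half-lines unbounded to the left, and inclusion decides the sign.\<close>

lemma measure_pos_reflect: "measure Q {c. 0 < c} = measure Q {c. c < 2 * mean}"
proof -
  have "measure (distr Q borel (\<lambda>c. c - mean)) {x. - mean < x} =
      measure (distr Q borel (\<lambda>c. mean - c)) {x. - mean < x}"
    by (simp add: symmetric)
  then show ?thesis
    by (simp add: measure_distr space_Q vimage_def algebra_simps)
qed

lemma sign_mean_nonneg: "0 \<le> mean \<Longrightarrow> 0 \<le> sign_mean"
  unfolding sign_mean_eq measure_pos_reflect by (auto simp: sets_Q intro!: finite_measure_mono)

lemma sign_mean_nonpos: "mean \<le> 0 \<Longrightarrow> sign_mean \<le> 0"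
  unfolding sign_mean_eq measure_pos_reflect by (auto simp: sets_Q intro!: finite_measure_mono)

lemma mean_mult_sign_mean: "mean * sign_mean = \<bar>mean\<bar> * \<bar>sign_mean\<bar>"
  using sign_mean_nonneg sign_mean_nonpos
  by (metis abs_mult abs_of_nonneg linorder_le_cases mult_nonneg_nonneg mult_nonpos_nonpos)

lemma mult_sign_mean_nonpos:
  assumes "mean * d \<le> 0"
  shows "d * sign_mean \<le> 0"
  using assms sign_mean_nonneg sign_mean_nonpos
  \<comment> \<open>If \<open>mean\<close> is 0, \<open>d\<close> is unrestricted, but the two sign
    lemmas together force \<open>sign_mean\<close> to be 0.\<close>
  by (cases mean "0::real" rule: linorder_cases)
     (auto simp: mult_le_0_iff intro: order_antisym)

text \<open>By reflection, the expected surrogate loss at \<open>mean\<close> is the expectation of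
  |c| minus \<open>mean * sign_mean\<close>. By convexity and the wrong sign of \<open>d\<close>, at
  \<open>d\<close> it is at least the expectation of |c|.\<close>

lemma integral_spo_plus_loss_diff_ge:
  assumes "mean * d \<le> 0"
  shows "\<bar>mean\<bar> * \<bar>sign_mean\<bar> \<le> (\<integral>c. spo_plus_loss d c \<partial>Q) - (\<integral>c. spo_plus_loss mean c \<partial>Q)"
  using integral_abs_diff_ge[of d] mult_sign_mean_nonpos[OF assms] mean_mult_sign_mean
  unfolding integral_spo_plus_loss integral_abs_reflect by (simp add: algebra_simps)

text \<open>The strict inequality counts \<open>d = 0\<close> as a wrong sign, as
  \<open>oracle_sol 0\<close> is neither endpoint. A right sign keeps \<open>d\<close>, so that the
  exchange below is then an equality.\<close>

definition correct_sign :: "real \<Rightarrow> real" where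
  "correct_sign d = (if 0 < mean * d then d else mean)"

text \<open>A wrong sign costs at most |mean| in true loss, which the factor \<alpha> turns into at
  most |mean| |sign_mean|. The inequality avoids subtraction so that it passes to
  \<open>ennreal\<close> and can be integrated over \<open>w\<close> even when the surrogate risk is
  infinite.\<close>

lemma correct_sign_exchange:
  assumes "0 \<le> \<alpha>" "\<alpha> \<le> \<bar>sign_mean\<bar>"
  shows "\<alpha> * (\<integral>c. true_loss d c \<partial>Q) + (\<integral>c. spo_plus_loss (correct_sign d) c \<partial>Q)
    \<le> \<alpha> * (\<integral>c. true_loss mean c \<partial>Q) + (\<integral>c. spo_plus_loss d c \<partial>Q)"
proof (cases "0 < mean * d")
  case True
  then have "oracle_sol d = oracle_sol mean"
    by (auto simp: oracle_sol_def zero_less_mult_iff)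
  then show ?thesis
    using True by (simp add: integral_true_loss correct_sign_def)
next
  case False
  have "\<alpha> * (\<integral>c. true_loss d c \<partial>Q) - \<alpha> * (\<integral>c. true_loss mean c \<partial>Q)
      = \<alpha> * (mean * oracle_sol d + \<bar>mean\<bar> / 2)"
    by (simp add: integral_true_loss mult_oracle_sol_self algebra_simps)
  also have "\<dots> \<le> \<alpha> * \<bar>mean\<bar>"
    using assms mult_oracle_sol_le[of mean d] by (intro mult_left_mono) auto
  also have "\<dots> \<le> \<bar>mean\<bar> * \<bar>sign_mean\<bar>"
    using mult_left_mono[OF assms(2), of "\<bar>mean\<bar>"] by (simp add: mult.commute)
  also have "\<dots> \<le> (\<integral>c. spo_plus_loss d c \<partial>Q) - (\<integral>c. spo_plus_loss mean c \<partial>Q)"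
    using False by (intro integral_spo_plus_loss_diff_ge) simp
  finally show ?thesis
    using False by (simp add: correct_sign_def)
qed

lemma nn_integral_true_loss:
  "(\<integral>\<^sup>+c. true_loss d c \<partial>Q) = ennreal (\<integral>c. true_loss d c \<partial>Q)"
  by (intro nn_integral_eq_integral integrable_true_loss AE_I2 true_loss_nonneg)

lemma nn_integral_spo_plus_loss:
  "(\<integral>\<^sup>+c. spo_plus_loss d c \<partial>Q) = ennreal (\<integral>c. spo_plus_loss d c \<partial>Q)"
  by (intro nn_integral_eq_integral integrable_spo_plus_loss AE_I2 spo_plus_loss_nonneg)

lemma nn_integral_true_loss_mean_le:
  "(\<integral>\<^sup>+c. true_loss mean c \<partial>Q) \<le> (\<integral>\<^sup>+c. true_loss d c \<partial>Q)"
  unfolding nn_integral_true_loss by (intro ennreal_leI integral_true_loss_mean_le)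

lemma nn_integral_correct_sign_exchange:
  assumes "0 \<le> \<alpha>" "\<alpha> \<le> \<bar>sign_mean\<bar>"
  shows "ennreal \<alpha> * (\<integral>\<^sup>+c. true_loss d c \<partial>Q) + (\<integral>\<^sup>+c. spo_plus_loss (correct_sign d) c \<partial>Q)
    \<le> ennreal \<alpha> * (\<integral>\<^sup>+c. true_loss mean c \<partial>Q) + (\<integral>\<^sup>+c. spo_plus_loss d c \<partial>Q)"
  using correct_sign_exchange[OF assms] assms
  unfolding nn_integral_true_loss nn_integral_spo_plus_loss
  by (simp add: true_loss_nonneg spo_plus_loss_nonneg flip: ennreal_mult' ennreal_plus)

end

section \<open>From an exchange inequality to an excess bound\<close>

text \<open>Applied both to the conditional expectations, with \<open>S = UNIV\<close>, and to the risks, with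
  \<open>S\<close> the measurable functions.\<close>

lemma excess_le_of_exchange:
  fixes A B :: "'b \<Rightarrow> ennreal" and \<alpha> :: real
  assumes "0 < \<alpha>"
    and min: "\<And>x. x \<in> S \<Longrightarrow> A e \<le> A x"
    and fin: "A d < \<infinity>" "A e < \<infinity>" "B z < \<infinity>"
    and S: "z \<in> S" "d' \<in> S"
    and exchange: "ennreal \<alpha> * A d + B d' \<le> ennreal \<alpha> * A e + B d"
  shows "enn2ereal (A d) - (INF x\<in>S. enn2ereal (A x))
    \<le> ereal (1 / \<alpha>) * (enn2ereal (B d) - (INF x\<in>S. enn2ereal (B x)))"
proof -
  define I where "I = (INF x\<in>S. enn2ereal (B x))"
  have I_le: "I \<le> enn2ereal (B x)" if "x \<in> S" for x
    unfolding I_def using that by (rule INF_lower)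
  have I_nonneg: "0 \<le> I"
    unfolding I_def by (intro INF_greatest) simp
  have Bz: "enn2ereal (B z) < \<infinity>"
    using fin(3) by (cases "B z") (auto simp: enn2ereal_ennreal)
  \<comment> \<open>The competitor \<open>z\<close> has finite \<open>B\<close>, so the infimum is a
    real number and no difference of infinities occurs below.\<close>
  obtain i where i: "I = ereal i"
    using I_nonneg I_le[OF S(1)] Bz by (cases I) auto
  have "enn2ereal (A e) \<le> (INF x\<in>S. enn2ereal (A x))"
    using min by (intro INF_greatest) (simp flip: less_eq_ennreal.rep_eq)
  then have "enn2ereal (A d) - (INF x\<in>S. enn2ereal (A x)) \<le> enn2ereal (A d) - enn2ereal (A e)"
    by (intro ereal_minus_mono) auto
  also have "\<dots> \<le> ereal (1 / \<alpha>) * (enn2ereal (B d) - I)"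
  proof (cases "B d")
    case (real b)
    obtain a where a: "A d = ennreal a" "0 \<le> a" using fin(1) by (cases "A d") auto
    obtain a' where a': "A e = ennreal a'" "0 \<le> a'" using fin(2) by (cases "A e") auto
    have rhs: "ennreal \<alpha> * A e + B d = ennreal (\<alpha> * a' + b)"
      using a' real \<open>0 < \<alpha>\<close> by (simp flip: ennreal_mult' ennreal_plus)
    \<comment> \<open>A finite \<open>B d\<close> bounds \<open>B d'\<close> through the exchange,
      so the rest is real arithmetic.\<close>
    have "B d' \<noteq> \<infinity>"
      using exchange unfolding rhs by (auto simp: top_unique)
    then obtain b' where b': "B d' = ennreal b'" "0 \<le> b'" by (cases "B d'") auto
    have "\<alpha> * a + b' \<le> \<alpha> * a' + b"
      using exchange unfolding rhs using a a' b' real \<open>0 < \<alpha>\<close>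
      by (simp flip: ennreal_mult' ennreal_plus)
    moreover have "i \<le> b'"
      using I_le[OF S(2)] b' i by (simp add: enn2ereal_ennreal)
    ultimately have "a - a' \<le> 1 / \<alpha> * (b - i)"
      using \<open>0 < \<alpha>\<close> by (simp add: field_simps)
    then show ?thesis
      using a a' real i by (simp add: enn2ereal_ennreal)
  next
    \<comment> \<open>An infinite surrogate value makes the right-hand side infinite, as
      \<open>I\<close> is real.\<close>
    case top
    then show ?thesis
      using \<open>0 < \<alpha>\<close> i by simp
  qed
  finally show ?thesis
    unfolding I_def .
qed

section \<open>Disintegration along the conditional distributions\<close>

text \<open>\<open>P\<close> is its marginal on \<open>W\<close> composed with the kernel that puts
  \<open>K w\<close> on the fibre over \<open>w\<close>. The definition of
  \<open>regular_conditional\<close> is this identity on rectangles, which generate the product and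
  are closed under intersection.\<close>

lemma nn_integral_regular_conditional:
  fixes W :: "'a::topological_space set"
  assumes prob: "prob_space P"
    and sets_P: "sets P = sets (restrict_space borel W \<Otimes>\<^sub>M borel)"
    and cond: "regular_conditional W P K"
    and f: "f \<in> borel_measurable (restrict_space borel W \<Otimes>\<^sub>M borel)"
  shows "(\<integral>\<^sup>+x. f x \<partial>P) =
    (\<integral>\<^sup>+w. (\<integral>\<^sup>+c. f (w, c) \<partial>K w) \<partial>distr P (restrict_space borel W) fst)"
proof -
  interpret P: prob_space P by fact
  let ?R = "restrict_space borel W :: 'a measure"
  let ?B = "?R \<Otimes>\<^sub>M (borel :: real measure)"
  let ?N = "distr P ?R fst"
  let ?k = "\<lambda>w. distr (K w) ?B (Pair w)"
  have K[measurable]: "K \<in> ?R \<rightarrow>\<^sub>M subprob_algebra borel"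
    using cond unfolding regular_conditional_def by (auto intro: measurable_prob_algebraD)
  have k: "?k \<in> ?N \<rightarrow>\<^sub>M subprob_algebra ?B"
    by (subst measurable_distr_eq1, rule measurable_distr2[OF _ K]) simp
  have setsK[measurable_cong]: "sets (K w) = sets borel" if "w \<in> W" for w
    using measurable_space[OF K, of w] that by (auto simp: space_restrict_space space_subprob_algebra)
  have Pair_meas: "Pair w \<in> K w \<rightarrow>\<^sub>M ?B" if "w \<in> W" for w
    using that setsK[OF that] by (subst measurable_cong_sets[OF setsK[OF that] refl])
       (auto intro!: measurable_Pair1' simp: space_restrict_space)
  have fst_meas: "fst \<in> P \<rightarrow>\<^sub>M ?R"
    by (subst measurable_cong_sets[OF sets_P refl]) simp
  have space_P: "space P = W \<times> UNIV"
    using sets_eq_imp_space_eq[OF sets_P] by (simp add: space_pair_measure space_restrict_space)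
  \<comment> \<open>\<open>bind\<close> has a degenerate default over an empty space, so its
    sigma-algebra is the expected one only for nonempty \<open>W\<close>.\<close>
  have W_nonempty: "W \<noteq> {}"
    using P.not_empty by (auto simp: space_P)
  then have N_nonempty: "space ?N \<noteq> {}"
    by (simp add: space_restrict_space)
  have "P = ?N \<bind> ?k"
  \<comment> \<open>The whole space is itself a rectangle of finite measure, so a constant sequence
    exhausts it.\<close>
  proof (rule measure_eqI_generator_eq[OF Int_stable_pair_measure_generator[of ?R borel],
        where A = "\<lambda>_. W \<times> UNIV" and \<Omega> = "W \<times> UNIV"])
    show "{a \<times> b |a b. a \<in> sets ?R \<and> b \<in> sets (borel :: real measure)} \<subseteq> Pow (W \<times> UNIV)"
      using sets.sets_into_space[of _ ?R] by (fastforce simp: space_restrict_space)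
    show "sets P = sigma_sets (W \<times> UNIV)
        {a \<times> b |a b. a \<in> sets ?R \<and> b \<in> sets (borel :: real measure)}"
      by (simp add: sets_P sets_pair_measure space_restrict_space)
    show "sets (?N \<bind> ?k) = sigma_sets (W \<times> UNIV)
        {a \<times> b |a b. a \<in> sets ?R \<and> b \<in> sets (borel :: real measure)}"
      by (subst sets_bind[where N = ?B])
         (auto simp: W_nonempty sets_pair_measure space_restrict_space)
    show "range (\<lambda>_. W \<times> UNIV) \<subseteq>
        {a \<times> b |a b. a \<in> sets ?R \<and> b \<in> sets (borel :: real measure)}"
      using sets.top[of ?R]
      by (auto simp: space_restrict_space intro!: exI[of _ W] exI[of _ "UNIV :: real set"])
  next
    fix X assume "X \<in> {a \<times> b |a b. a \<in> sets ?R \<and> b \<in> sets (borel :: real measure)}"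
    then obtain A B where X: "X = A \<times> B"
      and AB[measurable]: "A \<in> sets ?R" "B \<in> sets (borel :: real measure)"
      by auto
    have "emeasure (?N \<bind> ?k) X = (\<integral>\<^sup>+w. emeasure (?k w) X \<partial>?N)"
      using N_nonempty k by (rule emeasure_bind) (simp add: X)
    also have "\<dots> = (\<integral>\<^sup>+w. emeasure (K w) B * indicator A w \<partial>?N)"
    proof (rule nn_integral_cong)
      fix w assume "w \<in> space ?N"
      then have w: "w \<in> W" by (simp add: space_restrict_space)
      have "space (K w) = UNIV"
        using sets_eq_imp_space_eq[OF setsK[OF w]] by simp
      then show "emeasure (?k w) X = emeasure (K w) B * indicator A w"
        using Pair_meas[OF w] by (subst emeasure_distr) (auto simp: X indicator_def vimage_def)
    qed
    also have "\<dots> = emeasure P X"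
      using cond AB unfolding regular_conditional_def X by simp
    finally show "emeasure P X = emeasure (?N \<bind> ?k) X" ..
  qed (use P.emeasure_finite in auto)
  then have "(\<integral>\<^sup>+x. f x \<partial>P) = (\<integral>\<^sup>+x. f x \<partial>(?N \<bind> ?k))"
    by simp
  also have "\<dots> = (\<integral>\<^sup>+w. (\<integral>\<^sup>+x. f x \<partial>?k w) \<partial>?N)"
    using f k by (rule nn_integral_bind)
  also have "\<dots> = (\<integral>\<^sup>+w. (\<integral>\<^sup>+c. f (w, c) \<partial>K w) \<partial>?N)"
    using Pair_meas f
    by (intro nn_integral_cong nn_integral_distr) (auto simp: space_restrict_space)
  finally show ?thesis .
qed

section \<open>Conditional distributions and calibration\<close>

lemma symmetric_real_distributionI:
  assumes "prob_space Q" "sets Q = sets borel" "symmetric_distribution Q"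
  shows "symmetric_real_distribution Q"
proof -
  interpret prob_space Q by fact
  interpret integrable_real_distribution Q
    using assms by unfold_locales (auto simp: symmetric_distribution_def)
  show ?thesis
    using assms by unfold_locales (auto simp: symmetric_distribution_def mean_def Let_def)
qed

lemma cont_sym_distributionsD:
  assumes "(P, K) \<in> cont_sym_distributions W \<alpha>" "w \<in> W"
  shows "symmetric_real_distribution (K w)"
    and "\<alpha> \<le> \<bar>integrable_real_distribution.sign_mean (K w)\<bar>"
proof -
  have "K w \<in> space (prob_algebra borel)"
    using assms
    by (auto simp: cont_sym_distributions_def distributions_on_def regular_conditional_def
        space_restrict_space dest!: measurable_space[where x = w])
  then have *: "prob_space (K w)" "sets (K w) = sets borel"
    by (auto simp: space_prob_algebra)
  show "symmetric_real_distribution (K w)"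
    using * assms by (intro symmetric_real_distributionI) (auto simp: cont_sym_distributions_def)
  then interpret symmetric_real_distribution "K w" .
  show "\<alpha> \<le> \<bar>sign_mean\<bar>"
    using assms by (auto simp: cont_sym_distributions_def sign_mean_eq)
qed

lemma conditional_excess_le:
  assumes PK: "(P, K) \<in> cont_sym_distributions W \<alpha>" "w \<in> W" and "0 < \<alpha>"
  shows "expect (K w) (true_loss d) - (INF d'. expect (K w) (true_loss d'))
    \<le> ereal (1 / \<alpha>) * (expect (K w) (spo_plus_loss d) - (INF d'. expect (K w) (spo_plus_loss d')))"
proof -
  interpret symmetric_real_distribution "K w"
    using PK by (rule cont_sym_distributionsD)
  show ?thesis
    unfolding expect_nonneg[OF true_loss_nonneg] expect_nonneg[OF spo_plus_loss_nonneg]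
  \<comment> \<open>The competitors are numbers here, and every expectation involved is finite
    because \<open>K w\<close> has a finite mean.\<close>
  proof (rule excess_le_of_exchange[where e = mean and z = 0 and d' = "correct_sign d"])
    show "ennreal \<alpha> * (\<integral>\<^sup>+c. true_loss d c \<partial>K w) + (\<integral>\<^sup>+c. spo_plus_loss (correct_sign d) c \<partial>K w)
        \<le> ennreal \<alpha> * (\<integral>\<^sup>+c. true_loss mean c \<partial>K w) + (\<integral>\<^sup>+c. spo_plus_loss d c \<partial>K w)"
      using \<open>0 < \<alpha>\<close> cont_sym_distributionsD(2)[OF PK]
      by (intro nn_integral_correct_sign_exchange) auto
  qed (use \<open>0 < \<alpha>\<close> in \<open>auto simp: nn_integral_true_loss_mean_le\<close>,
      auto simp: nn_integral_true_loss nn_integral_spo_plus_loss)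
qed

lemma uniformly_calibrated_spo_plus_loss:
  assumes "0 < \<alpha>"
  shows "uniformly_calibrated W (cont_sym_distributions W \<alpha>) spo_plus_loss"
  unfolding uniformly_calibrated_def
proof (intro allI impI)
  fix \<epsilon> :: real assume "0 < \<epsilon>"
  show "\<exists>\<delta>>0. \<forall>(P, K)\<in>cont_sym_distributions W \<alpha>. \<forall>w\<in>W. \<forall>d.
    expect (K w) (spo_plus_loss d) - (INF d'. expect (K w) (spo_plus_loss d')) < ereal \<delta> \<longrightarrow>
    expect (K w) (true_loss d) - (INF d'. expect (K w) (true_loss d')) < ereal \<epsilon>"
  \<comment> \<open>The conditional bound is linear with slope \<open>1 / \<alpha>\<close>, so this
    choice serves every distribution, \<open>w\<close> and \<open>d\<close> alike.\<close>
  proof (intro exI[of _ "\<alpha> * \<epsilon>"] conjI ballI allI impI, goal_cases)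
    case 1
    then show ?case using \<open>0 < \<alpha>\<close> \<open>0 < \<epsilon>\<close> by simp
  next
    case (2 PK)
    show ?case
    proof (clarsimp split: prod.splits)
      fix P K w d
      assume PK: "PK = (P, K)" "w \<in> W"
        and *: "expect (K w) (spo_plus_loss d) - (INF d'. expect (K w) (spo_plus_loss d'))
          < ereal (\<alpha> * \<epsilon>)" (is "?E < _")
      have "expect (K w) (true_loss d) - (INF d'. expect (K w) (true_loss d'))
          \<le> ereal (1 / \<alpha>) * ?E"
        using 2 PK \<open>0 < \<alpha>\<close> by (intro conditional_excess_le) auto
      also have "\<dots> < ereal \<epsilon>"
        using * \<open>0 < \<alpha>\<close> by (cases ?E) (auto simp: field_simps)
      finally show "expect (K w) (true_loss d) - (INF d'. expect (K w) (true_loss d')) < ereal \<epsilon>" .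
    qed
  qed
qed

section \<open>Excess risk\<close>

text \<open>Disintegration turns both risks into integrals over \<open>w\<close>, to which the
  conditional inequalities apply pointwise. The competitors become the conditional mean, the zero
  function and the sign correction of \<open>g\<close>, so they have to be measurable in
  \<open>w\<close>.\<close>

lemma risk_excess_le:
  fixes W :: "'a::topological_space set"
  assumes PK: "(P, K) \<in> cont_sym_distributions W \<alpha>" and "0 < \<alpha>"
    and int: "integrable P (\<lambda>(w, c). \<bar>c\<bar>)"
    and g[measurable]: "g \<in> borel_measurable (restrict_space borel W)"
  shows "risk true_loss g P - min_risk W true_loss P
    \<le> ereal (1 / \<alpha>) * (risk spo_plus_loss g P - min_risk W spo_plus_loss P)"
proof -
  let ?R = "restrict_space borel W :: 'a measure"
  let ?N = "distr P ?R fst"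
  let ?M = "borel_measurable ?R"
  have P: "prob_space P" "sets P = sets (?R \<Otimes>\<^sub>M borel)" "regular_conditional W P K"
    using PK by (auto simp: cont_sym_distributions_def distributions_on_def)
  have K[measurable]: "K \<in> ?R \<rightarrow>\<^sub>M subprob_algebra borel"
    using P(3) unfolding regular_conditional_def by (auto intro: measurable_prob_algebraD)
  note sym = cont_sym_distributionsD[OF PK]
  define A where "A h = (\<integral>\<^sup>+x. ennreal (case x of (w, c) \<Rightarrow> true_loss (h w) c) \<partial>P)" for h :: "'a \<Rightarrow> real"
  define B where "B h = (\<integral>\<^sup>+x. ennreal (case x of (w, c) \<Rightarrow> spo_plus_loss (h w) c) \<partial>P)" for h :: "'a \<Rightarrow> real"
  have risk_A: "risk true_loss h P = enn2ereal (A h)" for h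
    unfolding risk_def A_def by (intro expect_nonneg) (auto simp: true_loss_nonneg)
  have risk_B: "risk spo_plus_loss h P = enn2ereal (B h)" for h
    unfolding risk_def B_def by (intro expect_nonneg) (auto simp: spo_plus_loss_nonneg)
  have A_eq: "A h = (\<integral>\<^sup>+w. (\<integral>\<^sup>+c. true_loss (h w) c \<partial>K w) \<partial>?N)" if [measurable]: "h \<in> ?M" for h
    unfolding A_def by (subst nn_integral_regular_conditional[OF P]) (simp_all add: split_beta)
  have B_eq: "B h = (\<integral>\<^sup>+w. (\<integral>\<^sup>+c. spo_plus_loss (h w) c \<partial>K w) \<partial>?N)" if [measurable]: "h \<in> ?M" for h
    unfolding B_def by (subst nn_integral_regular_conditional[OF P]) (simp_all add: split_beta)
  have abs_finite: "(\<integral>\<^sup>+x. ennreal (case x of (w, c) \<Rightarrow> \<bar>c\<bar>) \<partial>P) < \<infinity>"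
    using int by (auto simp: integrable_iff_bounded split_beta)
  have A_finite: "A h < \<infinity>" for h
  proof -
    have "A h \<le> (\<integral>\<^sup>+x. ennreal (case x of (w, c) \<Rightarrow> \<bar>c\<bar>) \<partial>P)"
      unfolding A_def by (intro nn_integral_mono ennreal_leI) (auto simp: true_loss_le_abs)
    then show ?thesis using abs_finite by (rule le_less_trans)
  qed
  \<comment> \<open>Finiteness is checked for the zero function only, as the surrogate risk of
    \<open>g\<close> may be infinite.\<close>
  have B_zero: "B (\<lambda>_. 0) < \<infinity>"
    using abs_finite by (simp add: B_def spo_plus_loss_zero)
  define m where "m w = (\<integral>c. c \<partial>K w)" for w
  have m: "m w = integrable_real_distribution.mean (K w)" if "w \<in> W" for w
  proof -
    interpret symmetric_real_distribution "K w" using that by (rule sym)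
    show ?thesis by (simp add: mean_def m_def)
  qed
  \<comment> \<open>Splitting into positive and negative parts reduces measurability of the mean in
    \<open>w\<close> to that of nonnegative kernel integrals.\<close>
  have m_meas[measurable]: "m \<in> ?M"
  proof (subst measurable_cong)
    fix w assume "w \<in> space ?R"
    then have "w \<in> W" by (simp add: space_restrict_space)
    then interpret symmetric_real_distribution "K w" by (rule sym)
    show "m w = enn2real (\<integral>\<^sup>+c. ennreal c \<partial>K w) - enn2real (\<integral>\<^sup>+c. ennreal (- c) \<partial>K w)"
      unfolding m_def by (rule real_lebesgue_integral_def[OF integrable_id])
  next
    show "(\<lambda>w. enn2real (\<integral>\<^sup>+c. ennreal c \<partial>K w) - enn2real (\<integral>\<^sup>+c. ennreal (- c) \<partial>K w)) \<in> ?M"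
      by measurable
  qed
  \<comment> \<open>This is \<open>correct_sign\<close> for each \<open>w\<close> in
    \<open>W\<close>, spelled out with \<open>m\<close> so that measurability is visible.\<close>
  define g' where "g' w = (if 0 < m w * g w then g w else m w)" for w
  have g'_meas[measurable]: "g' \<in> ?M"
    unfolding g'_def by measurable
  have spaceN: "w \<in> space ?N \<Longrightarrow> w \<in> W" for w
    by (simp add: space_restrict_space)
  have meas_inner[measurable]:
    "(\<lambda>w. \<integral>\<^sup>+c. true_loss (h w) c \<partial>K w) \<in> borel_measurable ?R"
    "(\<lambda>w. \<integral>\<^sup>+c. spo_plus_loss (h w) c \<partial>K w) \<in> borel_measurable ?R"
    if [measurable]: "h \<in> ?M" for h
    by (rule nn_integral_measurable_subprob_algebra2[OF _ K]; simp add: split_beta)+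
  have min: "A m \<le> A h" if h: "h \<in> ?M" for h
    unfolding A_eq[OF h] A_eq[OF m_meas]
  proof (rule nn_integral_mono)
    fix w assume "w \<in> space ?N"
    note w = spaceN[OF this]
    interpret symmetric_real_distribution "K w" using w by (rule sym)
    show "(\<integral>\<^sup>+c. true_loss (m w) c \<partial>K w) \<le> (\<integral>\<^sup>+c. true_loss (h w) c \<partial>K w)"
      unfolding m[OF w] by (rule nn_integral_true_loss_mean_le)
  qed
  have "ennreal \<alpha> * A g + B g' =
      (\<integral>\<^sup>+w. ennreal \<alpha> * (\<integral>\<^sup>+c. true_loss (g w) c \<partial>K w) + (\<integral>\<^sup>+c. spo_plus_loss (g' w) c \<partial>K w) \<partial>?N)"
    by (simp add: A_eq B_eq nn_integral_add nn_integral_cmult)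
  also have "\<dots> \<le>
      (\<integral>\<^sup>+w. ennreal \<alpha> * (\<integral>\<^sup>+c. true_loss (m w) c \<partial>K w) + (\<integral>\<^sup>+c. spo_plus_loss (g w) c \<partial>K w) \<partial>?N)"
  proof (rule nn_integral_mono)
    fix w assume "w \<in> space ?N"
    note w = spaceN[OF this]
    interpret symmetric_real_distribution "K w" using w by (rule sym)
    have "g' w = correct_sign (g w)"
      by (simp add: g'_def correct_sign_def m[OF w])
    then show "ennreal \<alpha> * (\<integral>\<^sup>+c. true_loss (g w) c \<partial>K w) + (\<integral>\<^sup>+c. spo_plus_loss (g' w) c \<partial>K w)
        \<le> ennreal \<alpha> * (\<integral>\<^sup>+c. true_loss (m w) c \<partial>K w) + (\<integral>\<^sup>+c. spo_plus_loss (g w) c \<partial>K w)"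
      using nn_integral_correct_sign_exchange[of \<alpha> "g w"] \<open>0 < \<alpha>\<close> sym(2)[OF w] by (simp add: m[OF w])
  qed
  also have "\<dots> = ennreal \<alpha> * A m + B g"
    by (simp add: A_eq B_eq nn_integral_add nn_integral_cmult)
  finally have exchange: "ennreal \<alpha> * A g + B g' \<le> ennreal \<alpha> * A m + B g" .
  show ?thesis
    unfolding min_risk_def risk_A risk_B
    by (rule excess_le_of_exchange[where e = m and z = "\<lambda>_. 0" and d' = g'])
       (use \<open>0 < \<alpha>\<close> min A_finite B_zero exchange in auto)
qed

theorem proposition2:
  fixes W :: "(real ^ 'k) set" and \<alpha> :: real
  assumes "W \<in> sets borel" and "\<alpha> > 0"
  shows "uniformly_calibrated W (cont_sym_distributions W \<alpha>) spo_plus_loss \<and>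
    (\<forall>(P, K)\<in>cont_sym_distributions W \<alpha>. integrable P (\<lambda>(w, c). \<bar>c\<bar>) \<longrightarrow>
      (\<forall>g\<in>borel_measurable (restrict_space borel W).
        risk true_loss g P - min_risk W true_loss P
          \<le> ereal (1 / \<alpha>) * (risk spo_plus_loss g P - min_risk W spo_plus_loss P)))"
  using uniformly_calibrated_spo_plus_loss[OF assms(2)] risk_excess_le[OF _ assms(2)] by blast

end
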